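(* Let $1\le p<\infty$, let $d\ge 1$, let $\mathcal{X}$ be a reflexive Banach space and $\mathcal{Y}$ a Banach space over $\mathbb{F}$. Let $\mathcal{T}=(T_1,\dots,T_d)$ and $\mathcal{S}=(S_1,\dots,S_d)$ belong to $\mathcal{K}(\mathcal{X},\ell_p^d(\mathcal{Y}))$, with $\mathcal{T}\notin\mathbb{F}^d\mathcal{S}$. Let $\mathbf{z}^0=(z_1^0,\dots,z_d^0)\in\mathbb{F}^d$, $\mathcal{T}^0=\mathcal{T}-\mathbf{z}^0\mathcal{S}$ and $T_j^0=T_j-z_j^0S_j$, and suppose that $dist(\mathcal{T},\mathbb{F}^d\mathcal{S})=\|\mathcal{T}^0\|$. Suppose $\bigcap_{j=1}^d M_{T_j^0}\neq\emptyset$. Then \[dist(T_j,\mathbb{F}S_j)=\|T_j^0\|\quad\text{for all }1\le j\le d,\] and \[dist(\mathcal{T},\mathbb{F}^d\mathcal{S})^p=\sum_{j=1}^d dist(T_j,\mathbb{F}S_j)^p.\]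
   Context: $\mathbb{F}$ is $\mathbb{R}$ or $\mathbb{C}$. $\ell_p^d(\mathcal{Y})$ is the direct sum of $d$ copies of $\mathcal{Y}$ with norm $\|(y_1,\dots,y_d)\|_p=(\sum_{i=1}^d\|y_i\|^p)^{1/p}$. $\mathcal{K}(\mathcal{X},\mathcal{Y})$ is the space of compact linear operators from $\mathcal{X}$ to $\mathcal{Y}$ with the operator norm. A tuple $\mathcal{T}=(T_1,\dots,T_d)$ with $T_k:\mathcal{X}\to\mathcal{Y}$ is identified with the operator $x\mapsto(T_1x,\dots,T_dx)$ into $\ell_p^d(\mathcal{Y})$, and $\|\mathcal{T}\|$ is its operator norm. For $\mathbf{z}=(z_1,\dots,z_d)\in\mathbb{F}^d$, $\mathbf{z}\mathcal{S}=(z_1S_1,\dots,z_dS_d)$, and $\mathbb{F}^d\mathcal{S}=\{\mathbf{z}\mathcal{S}:\mathbf{z}\in\mathbb{F}^d\}$; $\mathbb{F}S_j=\{zS_j:z\in\mathbb{F}\}$. For an element $x$ and a subspace $W$ of a Banach space, $dist(x,W)=\inf\{\|x-w\|:w\in W\}$. $S_{\mathcal{X}}$ is the unit sphere of $\mathcal{X}$, and $M_T=\{x\in S_{\mathcal{X}}:\|Tx\|=\|T\|\}$ is the norm attainment set of an operator $T$ on $\mathcal{X}$. *)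

theory Defs
  imports "HOL-Analysis.Analysis"
begin

text \<open>
  The scalar field is the real or the complex numbers. The class contains exactly the normed
  fields that are isometrically isomorphic, over the reals, to one of these two.
\<close>

class real_or_complex = real_normed_field +
  assumes ex_real_or_complex_iso:
    "\<exists>\<phi> :: 'a \<Rightarrow> complex.
       (\<forall>a b. \<phi> (a + b) = \<phi> a + \<phi> b) \<and> (\<forall>a b. \<phi> (a * b) = \<phi> a * \<phi> b) \<and>
       (\<forall>r a. \<phi> (r *\<^sub>R a) = r *\<^sub>R \<phi> a) \<and> (\<forall>a. norm (\<phi> a) = norm a) \<and>
       (range \<phi> = \<real> \<or> range \<phi> = UNIV)"

instance real :: real_or_complex
proof
  show "\<exists>\<phi> :: real \<Rightarrow> complex.
       (\<forall>a b. \<phi> (a + b) = \<phi> a + \<phi> b) \<and> (\<forall>a b. \<phi> (a * b) = \<phi> a * \<phi> b) \<and>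
       (\<forall>r a. \<phi> (r *\<^sub>R a) = r *\<^sub>R \<phi> a) \<and> (\<forall>a. norm (\<phi> a) = norm a) \<and>
       (range \<phi> = \<real> \<or> range \<phi> = UNIV)"
    by (rule exI[of _ complex_of_real]) (simp add: Reals_def scaleR_conv_of_real)
qed

instance complex :: real_or_complex
proof
  show "\<exists>\<phi> :: complex \<Rightarrow> complex.
       (\<forall>a b. \<phi> (a + b) = \<phi> a + \<phi> b) \<and> (\<forall>a b. \<phi> (a * b) = \<phi> a * \<phi> b) \<and>
       (\<forall>r a. \<phi> (r *\<^sub>R a) = r *\<^sub>R \<phi> a) \<and> (\<forall>a. norm (\<phi> a) = norm a) \<and>
       (range \<phi> = \<real> \<or> range \<phi> = UNIV)"
    by (rule exI[of _ "\<lambda>z. z"]) simp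
qed

text \<open>
  The library has only real Banach spaces as a type class, so the scalar multiplication over the
  field is an explicit parameter, extending the real scalar multiplication of the type.
\<close>

definition banach_space_over :: "('k::real_or_complex \<Rightarrow> 'a::banach \<Rightarrow> 'a) \<Rightarrow> bool" where
  "banach_space_over m \<longleftrightarrow>
     vector_space m \<and>
     (\<forall>c x. norm (m c x) = norm c * norm x) \<and>
     (\<forall>r x. m (of_real r) x = r *\<^sub>R x)"

definition dual_space ::
    "('k::real_or_complex \<Rightarrow> 'a::banach \<Rightarrow> 'a) \<Rightarrow> ('a \<Rightarrow> 'k) set" where
  "dual_space m =
     {f. Vector_Spaces.linear m (*) f \<and> (\<exists>C. \<forall>x. norm (f x) \<le> C * norm x)}"

text \<open>Only the values of a bidual functional on the dual space are relevant.\<close>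

definition bidual_functional ::
    "('k::real_or_complex \<Rightarrow> 'a::banach \<Rightarrow> 'a) \<Rightarrow> (('a \<Rightarrow> 'k) \<Rightarrow> 'k) \<Rightarrow> bool" where
  "bidual_functional m \<Phi> \<longleftrightarrow>
     (\<forall>f\<in>dual_space m. \<forall>g\<in>dual_space m. \<Phi> (\<lambda>x. f x + g x) = \<Phi> f + \<Phi> g) \<and>
     (\<forall>c. \<forall>f\<in>dual_space m. \<Phi> (\<lambda>x. c * f x) = c * \<Phi> f) \<and>
     (\<exists>C. \<forall>f\<in>dual_space m. norm (\<Phi> f) \<le> C * onorm f)"

text \<open>Surjectivity of the canonical embedding into the bidual.\<close>

definition reflexive_space :: "('k::real_or_complex \<Rightarrow> 'a::banach \<Rightarrow> 'a) \<Rightarrow> bool" where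
  "reflexive_space m \<longleftrightarrow>
     (\<forall>\<Phi>. bidual_functional m \<Phi> \<longrightarrow> (\<exists>x. \<forall>f\<in>dual_space m. \<Phi> f = f x))"

text \<open>
  The direct sum of copies of a space is the vector type, but the norm used on it is
  \<open>lp_norm p\<close>, not the Euclidean one of the type class. Hence the
  notions below for operators into it take the norm of the codomain as an argument.
\<close>

definition lp_norm :: "real \<Rightarrow> 'y::real_normed_vector ^ 'n \<Rightarrow> real" where
  "lp_norm p y = (\<Sum>i\<in>UNIV. norm (y $ i) powr p) powr (1 / p)"

definition lp_scale :: "('k \<Rightarrow> 'y \<Rightarrow> 'y) \<Rightarrow> 'k \<Rightarrow> 'y ^ 'n \<Rightarrow> 'y ^ 'n" where
  "lp_scale m c y = (\<chi> i. m c (y $ i))"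

text \<open>\<open>onorm\<close> for an arbitrary norm \<open>N\<close> on the codomain.\<close>

definition op_norm :: "('z \<Rightarrow> real) \<Rightarrow> ('x::real_normed_vector \<Rightarrow> 'z) \<Rightarrow> real" where
  "op_norm N A = (SUP x. N (A x) / norm x)"

definition compact_operators ::
    "('k::real_or_complex \<Rightarrow> 'x::banach \<Rightarrow> 'x) \<Rightarrow> ('k \<Rightarrow> 'z::ab_group_add \<Rightarrow> 'z) \<Rightarrow>
     ('z \<Rightarrow> real) \<Rightarrow> ('x \<Rightarrow> 'z) set" where
  "compact_operators scaleX scaleZ N =
     {A. Vector_Spaces.linear scaleX scaleZ A \<and>
         (\<forall>u :: nat \<Rightarrow> 'x. bounded (range u) \<longrightarrow>
            (\<exists>l r. strict_mono r \<and> (\<lambda>n. N (A (u (r n)) - l)) \<longlonglongrightarrow> 0))}"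

definition tuple_op :: "('n::finite \<Rightarrow> 'x \<Rightarrow> 'y) \<Rightarrow> 'x \<Rightarrow> 'y ^ 'n" where
  "tuple_op T x = (\<chi> j. T j x)"

definition tuple_norm ::
    "real \<Rightarrow> ('n::finite \<Rightarrow> 'x::real_normed_vector \<Rightarrow> 'y::real_normed_vector) \<Rightarrow> real" where
  "tuple_norm p T = op_norm (lp_norm p) (tuple_op T)"

definition tuple_scale ::
    "('k \<Rightarrow> 'y \<Rightarrow> 'y) \<Rightarrow> 'k ^ 'n \<Rightarrow> ('n::finite \<Rightarrow> 'x \<Rightarrow> 'y) \<Rightarrow> 'n \<Rightarrow> 'x \<Rightarrow> 'y" where
  "tuple_scale m z S = (\<lambda>j x. m (z $ j) (S j x))"

definition tuple_multiples ::
    "('k \<Rightarrow> 'y \<Rightarrow> 'y) \<Rightarrow> ('n::finite \<Rightarrow> 'x \<Rightarrow> 'y) \<Rightarrow> ('n::finite \<Rightarrow> 'x \<Rightarrow> 'y) set" where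
  "tuple_multiples m S = {tuple_scale m z S | z. True}"

definition op_multiples ::
    "('k \<Rightarrow> 'y \<Rightarrow> 'y) \<Rightarrow> ('x \<Rightarrow> 'y) \<Rightarrow> ('x \<Rightarrow> 'y) set" where
  "op_multiples m A = {(\<lambda>x. m c (A x)) | c. True}"

text \<open>
  Distance to a set with respect to a norm \<open>N\<close>. The function types of operators and tuples
  are not metric spaces in the type-class sense, so \<open>infdist\<close> does not apply.
\<close>

definition dist_to :: "('a::minus \<Rightarrow> real) \<Rightarrow> 'a \<Rightarrow> 'a set \<Rightarrow> real" where
  "dist_to N a W = (INF w\<in>W. N (a - w))"

definition norm_attainment_set ::
    "('x::real_normed_vector \<Rightarrow> 'y::real_normed_vector) \<Rightarrow> 'x set" where
  "norm_attainment_set A = {x. norm x = 1 \<and> norm (A x) = onorm A}"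

end

theory Submission
  imports Defs
begin

text \<open>
  Two facts carry the proof. For every tuple of bounded operators,
  \<open>\<parallel>(A\<^sub>1, \<dots>, A\<^sub>d)\<parallel>\<^sup>p \<le> \<Sum>\<^sub>j \<parallel>A\<^sub>j\<parallel>\<^sup>p\<close>
  (\<open>tuple_norm_powr_le\<close>), because each \<open>\<parallel>A\<^sub>j x\<parallel>\<close> is at most
  \<open>\<parallel>A\<^sub>j\<parallel> \<parallel>x\<parallel>\<close>; and equality holds as soon as one unit vector attains the norms of all
  the components simultaneously (\<open>tuple_norm_powr_eq\<close>).

  The entries of \<open>z\<close> can be changed independently of each other. If some scalar
  \<open>c\<close> satisfied \<open>\<parallel>T\<^sub>j - c S\<^sub>j\<parallel> < \<parallel>T\<^sub>j\<^sup>0\<parallel>\<close>, then putting \<open>c\<close> in place of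
  the \<open>j\<close>-th entry of the best approximant would strictly decrease one summand of
  \<open>\<Sum>\<^sub>i \<parallel>T\<^sub>i\<^sup>0\<parallel>\<^sup>p\<close> and leave the others alone. By the inequality for the modified tuple
  and the equality for the original one, the modified tuple would have a norm strictly below the
  distance, which is impossible. So every \<open>T\<^sub>j\<^sup>0\<close> has minimal norm, and the
  formula for the distance is the equality case again.

  Compactness makes the components bounded (\<open>compact_tuple_component_bounded_linear\<close>),
  so that the suprema that define the operator norms are finite.
\<close>

lemma lp_norm_powr:
  assumes "1 \<le> p"
  shows "lp_norm p y powr p = (\<Sum>i\<in>UNIV. norm (y $ i) powr p)"
  using assms by (simp add: lp_norm_def powr_powr sum_nonneg)

lemma lp_norm_nonneg: "0 \<le> lp_norm p y"
  by (simp add: lp_norm_def)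

lemma norm_component_le_lp_norm:
  fixes y :: "'y::real_normed_vector ^ 'n::finite"
  assumes "1 \<le> p"
  shows "norm (y $ j) \<le> lp_norm p y"
proof -
  have "norm (y $ j) powr p \<le> (\<Sum>i\<in>UNIV. norm (y $ i) powr p)"
    by (rule member_le_sum) auto
  then have "norm (y $ j) powr p \<le> lp_norm p y powr p"
    using assms by (simp add: lp_norm_powr)
  then show ?thesis
    using assms by (metis lp_norm_nonneg not_le powr_less_mono2 less_le_trans zero_less_one)
qed

lemma banach_space_over_bounded_linear:
  assumes "banach_space_over m"
  shows "bounded_linear (m c)"
proof
  interpret vector_space m
    using assms by (simp add: banach_space_over_def)
  fix x y and r :: real
  have real: "\<And>r x. m (of_real r) x = r *\<^sub>R x"
    using assms by (simp add: banach_space_over_def)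
  show "m c (x + y) = m c x + m c y"
    by (rule scale_right_distrib)
  show "m c (r *\<^sub>R x) = r *\<^sub>R m c x"
    by (metis real scale_left_commute)
  show "\<exists>K. \<forall>x. norm (m c x) \<le> norm x * K"
    using assms by (auto simp: banach_space_over_def mult.commute intro!: exI[of _ "norm c"])
qed

text \<open>
  On the unit sphere a component of a compact operator cannot take values of norm above every
  \<open>n\<close>: the images of such vectors would have a convergent, hence bounded, subsequence.
\<close>

lemma compact_tuple_component_bounded_linear:
  fixes T :: "'n::finite \<Rightarrow> 'x::banach \<Rightarrow> 'y::banach"
  assumes p: "1 \<le> p"
    and X: "banach_space_over scaleX" and Y: "banach_space_over scaleY"
    and T: "tuple_op T \<in> compact_operators scaleX (lp_scale scaleY) (lp_norm p)"
  shows "bounded_linear (T j)"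
proof -
  have comp: "tuple_op T x $ j = T j x" for x
    by (simp add: tuple_op_def)
  have hom: "module_hom scaleX (lp_scale scaleY) (tuple_op T)"
    using T by (simp add: compact_operators_def Vector_Spaces.linear_def)
  have add: "T j (x + y) = T j x + T j y" for x y
    using module_hom.add[OF hom, of x y] by (metis comp vector_add_component)
  have "T j (scaleX c x) = scaleY c (T j x)" for c x
    using module_hom.scale[OF hom, of c x] by (simp add: tuple_op_def lp_scale_def vec_eq_iff)
  then have scale: "T j (r *\<^sub>R x) = r *\<^sub>R T j x" for r x
    using X Y by (metis banach_space_over_def)
  have "\<exists>K. \<forall>x. norm x = 1 \<longrightarrow> norm (T j x) \<le> K"
  proof (rule ccontr)
    assume "\<not> ?thesis"
    then have "\<forall>n::nat. \<exists>x. norm x = 1 \<and> norm (T j x) > real n"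
      by (metis not_le)
    then obtain u :: "nat \<Rightarrow> 'x" where u: "\<And>n. norm (u n) = 1" "\<And>n. norm (T j (u n)) > real n"
      by metis
    have "bounded (range u)"
      using u(1) by (auto simp: bounded_iff)
    then obtain l r where r: "strict_mono r"
      and lim: "(\<lambda>n. lp_norm p (tuple_op T (u (r n)) - l)) \<longlonglongrightarrow> 0"
      using T unfolding compact_operators_def by blast
    have "(\<lambda>n. T j (u (r n)) - l $ j) \<longlonglongrightarrow> 0"
    proof (rule Lim_null_comparison[OF _ lim], intro always_eventually allI)
      fix n
      show "norm (T j (u (r n)) - l $ j) \<le> lp_norm p (tuple_op T (u (r n)) - l)"
        using norm_component_le_lp_norm[OF p, of "tuple_op T (u (r n)) - l" j]
        by (simp add: comp)
    qed
    then have "convergent (\<lambda>n. T j (u (r n)))"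
      by (auto simp: convergent_def LIM_zero_iff)
    then obtain K where K: "\<And>n. norm (T j (u (r n))) \<le> K"
      by (metis convergent_imp_Bseq BseqE)
    obtain n where "K < real n"
      using reals_Archimedean2 by blast
    also have "real n \<le> real (r n)"
      using r by (simp add: seq_suble)
    also have "\<dots> < norm (T j (u (r n)))"
      by (rule u(2))
    finally show False
      using K[of n] by simp
  qed
  then obtain K where K: "\<And>x. norm x = 1 \<Longrightarrow> norm (T j x) \<le> K"
    by blast
  show ?thesis
  proof (rule bounded_linear_intro[OF add scale])
    fix x
    show "norm (T j x) \<le> norm x * K"
    proof (cases "x = 0")
      case True
      then show ?thesis using scale[of 0 0] by simp
    next
      case False
      then have "norm (T j (inverse (norm x) *\<^sub>R x)) \<le> K"
        by (intro K) simp
      then show ?thesis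
        using False by (simp add: scale field_simps)
    qed
  qed
qed

lemma lp_norm_tuple_op_le:
  fixes A :: "'n::finite \<Rightarrow> 'x::real_normed_vector \<Rightarrow> 'y::real_normed_vector"
  assumes p: "1 \<le> p" and A: "\<And>j. bounded_linear (A j)"
  shows "lp_norm p (tuple_op A x) / norm x \<le> (\<Sum>j\<in>UNIV. onorm (A j) powr p) powr (1 / p)"
proof (cases "x = 0")
  case False
  have "lp_norm p (tuple_op A x) \<le> (\<Sum>j\<in>UNIV. (onorm (A j) * norm x) powr p) powr (1 / p)"
    unfolding lp_norm_def tuple_op_def using p
    by (intro powr_mono2 sum_mono sum_nonneg) (auto intro: onorm[OF A])
  also have "(\<Sum>j\<in>UNIV. (onorm (A j) * norm x) powr p)
      = (\<Sum>j\<in>UNIV. onorm (A j) powr p) * norm x powr p"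
    by (simp add: powr_mult onorm_pos_le[OF A] sum_distrib_right)
  also have "\<dots> powr (1 / p) = (\<Sum>j\<in>UNIV. onorm (A j) powr p) powr (1 / p) * norm x"
    using p by (simp add: powr_mult sum_nonneg powr_powr)
  finally show ?thesis
    using False by (simp add: divide_le_eq)
qed simp

lemma lp_norm_le_tuple_norm:
  fixes A :: "'n::finite \<Rightarrow> 'x::real_normed_vector \<Rightarrow> 'y::real_normed_vector"
  assumes "1 \<le> p" and "\<And>j. bounded_linear (A j)"
  shows "lp_norm p (tuple_op A x) / norm x \<le> tuple_norm p A"
  unfolding tuple_norm_def op_norm_def
  by (rule cSUP_upper)
    (auto intro!: bdd_aboveI2[of _ _ "(\<Sum>j\<in>UNIV. onorm (A j) powr p) powr (1 / p)"]
      lp_norm_tuple_op_le assms)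

lemma tuple_norm_nonneg:
  fixes A :: "'n::finite \<Rightarrow> 'x::real_normed_vector \<Rightarrow> 'y::real_normed_vector"
  assumes "1 \<le> p" and "\<And>j. bounded_linear (A j)"
  shows "0 \<le> tuple_norm p A"
  using lp_norm_le_tuple_norm[OF assms, where x = 0] by simp

lemma tuple_norm_powr_le:
  fixes A :: "'n::finite \<Rightarrow> 'x::real_normed_vector \<Rightarrow> 'y::real_normed_vector"
  assumes p: "1 \<le> p" and A: "\<And>j. bounded_linear (A j)"
  shows "tuple_norm p A powr p \<le> (\<Sum>j\<in>UNIV. onorm (A j) powr p)"
proof -
  have "tuple_norm p A \<le> (\<Sum>j\<in>UNIV. onorm (A j) powr p) powr (1 / p)"
    unfolding tuple_norm_def op_norm_def
    by (rule cSUP_least) (auto intro: lp_norm_tuple_op_le[OF p A])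
  then have "tuple_norm p A powr p \<le> ((\<Sum>j\<in>UNIV. onorm (A j) powr p) powr (1 / p)) powr p"
    using p by (intro powr_mono2 tuple_norm_nonneg A) auto
  then show ?thesis
    using p by (simp add: powr_powr sum_nonneg)
qed

text \<open>
  At a unit vector that attains all the component norms, the \<open>p\<close>-th power of the
  \<open>\<ell>\<^sub>p\<close> norm of the image is exactly the upper bound.
\<close>

lemma tuple_norm_powr_eq:
  fixes A :: "'n::finite \<Rightarrow> 'x::real_normed_vector \<Rightarrow> 'y::real_normed_vector"
  assumes p: "1 \<le> p" and A: "\<And>j. bounded_linear (A j)"
    and att: "(\<Inter>j. norm_attainment_set (A j)) \<noteq> {}"
  shows "tuple_norm p A powr p = (\<Sum>j\<in>UNIV. onorm (A j) powr p)"
proof (rule antisym)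
  obtain x where x: "norm x = 1" "\<And>j. norm (A j x) = onorm (A j)"
    using att by (auto simp: norm_attainment_set_def)
  have "(\<Sum>j\<in>UNIV. onorm (A j) powr p) = lp_norm p (tuple_op A x) powr p"
    using p by (simp add: lp_norm_powr tuple_op_def x)
  also have "\<dots> \<le> tuple_norm p A powr p"
    using p lp_norm_le_tuple_norm[OF p A, where x = x]
    by (intro powr_mono2) (auto simp: lp_norm_nonneg x)
  finally show "(\<Sum>j\<in>UNIV. onorm (A j) powr p) \<le> tuple_norm p A powr p" .
qed (rule tuple_norm_powr_le[OF p A])

lemma dist_to_le:
  assumes "w \<in> W" and "\<And>v. v \<in> W \<Longrightarrow> 0 \<le> N (a - v)"
  shows "dist_to N a W \<le> N (a - w)"
  unfolding dist_to_def using assms by (intro cINF_lower bdd_belowI2) auto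

lemma dist_to_eqI:
  assumes "w \<in> W" and "\<And>v. v \<in> W \<Longrightarrow> N (a - w) \<le> N (a - v)"
  shows "dist_to N a W = N (a - w)"
  unfolding dist_to_def using assms by (intro cInf_eq_minimum) auto

theorem theorem2p3:
  fixes p :: real
    and scaleX :: "'k::real_or_complex \<Rightarrow> 'x::banach \<Rightarrow> 'x"
    and scaleY :: "'k \<Rightarrow> 'y::banach \<Rightarrow> 'y"
    and T S T0 :: "'n::finite \<Rightarrow> 'x \<Rightarrow> 'y"
    and z0 :: "'k ^ 'n"
  assumes "1 \<le> p"
    and "banach_space_over scaleX" and "reflexive_space scaleX"
    and "banach_space_over scaleY"
    and "tuple_op T \<in> compact_operators scaleX (lp_scale scaleY) (lp_norm p)"
    and "tuple_op S \<in> compact_operators scaleX (lp_scale scaleY) (lp_norm p)"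
    and "T \<notin> tuple_multiples scaleY S"
    and "T0 = T - tuple_scale scaleY z0 S"
    and "dist_to (tuple_norm p) T (tuple_multiples scaleY S) = tuple_norm p T0"
    and "(\<Inter>j. norm_attainment_set (T0 j)) \<noteq> {}"
  shows "(\<forall>j. dist_to onorm (T j) (op_multiples scaleY (S j)) = onorm (T0 j)) \<and>
    dist_to (tuple_norm p) T (tuple_multiples scaleY S) powr p =
      (\<Sum>j\<in>UNIV. dist_to onorm (T j) (op_multiples scaleY (S j)) powr p)"
proof -
  have T: "bounded_linear (T j)" and S: "bounded_linear (S j)" for j
    using compact_tuple_component_bounded_linear assms by blast+
  have comp: "(T - tuple_scale scaleY z S) j = T j - (\<lambda>x. scaleY (z $ j) (S j x))" for z j
    by (simp add: tuple_scale_def)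
  have bl: "bounded_linear ((T - tuple_scale scaleY z S) j)" for z j
    unfolding comp unfolding fun_diff_def
    by (intro bounded_linear_sub T
        bounded_linear_compose[OF banach_space_over_bounded_linear[OF assms(4)] S])
  have T0: "bounded_linear (T0 j)" for j
    unfolding assms(8) by (rule bl)
  have dist_le: "tuple_norm p T0 \<le> tuple_norm p (T - tuple_scale scaleY z S)" for z
    unfolding assms(9)[symmetric]
  proof (rule dist_to_le)
    show "tuple_scale scaleY z S \<in> tuple_multiples scaleY S"
      by (auto simp: tuple_multiples_def)
    show "0 \<le> tuple_norm p (T - V)" if "V \<in> tuple_multiples scaleY S" for V
      using that tuple_norm_nonneg[OF assms(1) bl] by (auto simp only: tuple_multiples_def)
  qed
  have eq: "tuple_norm p T0 powr p = (\<Sum>j\<in>UNIV. onorm (T0 j) powr p)"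
    by (rule tuple_norm_powr_eq[OF assms(1) T0 assms(10)])
  have min: "onorm (T0 j) \<le> onorm (T j - (\<lambda>x. scaleY c (S j x)))" for j c
  proof (rule ccontr)
    assume less: "\<not> ?thesis"
    define z where "z = (\<chi> i. if i = j then c else z0 $ i)"
    define A where "A = T - tuple_scale scaleY z S"
    have A: "bounded_linear (A i)" for i
      unfolding A_def by (rule bl)
    have Aj: "onorm (A j) < onorm (T0 j)"
      using less unfolding A_def comp by (simp add: z_def)
    have Ai: "A i = T0 i" if "i \<noteq> j" for i
      using that unfolding A_def assms(8) comp by (simp add: z_def)
    have "tuple_norm p A powr p \<le> (\<Sum>i\<in>UNIV. onorm (A i) powr p)"
      by (rule tuple_norm_powr_le[OF assms(1) A])
    also have "\<dots> < (\<Sum>i\<in>UNIV. onorm (T0 i) powr p)"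
    proof (rule sum_strict_mono_ex1)
      show "\<forall>i\<in>UNIV. onorm (A i) powr p \<le> onorm (T0 i) powr p"
        using Aj Ai assms(1) by (metis less_eq_real_def order_refl onorm_pos_le[OF A]
            powr_mono2 order_trans zero_le_one)
      show "\<exists>i\<in>UNIV. onorm (A i) powr p < onorm (T0 i) powr p"
        using Aj assms(1) by (intro bexI[of _ j] powr_less_mono2 onorm_pos_le[OF A]) auto
    qed simp
    also have "\<dots> = tuple_norm p T0 powr p"
      by (rule eq[symmetric])
    also have "\<dots> \<le> tuple_norm p A powr p"
      using assms(1) dist_le[of z]
      by (intro powr_mono2 tuple_norm_nonneg[OF assms(1) T0]) (auto simp: A_def)
    finally show False
      by simp
  qed
  have dist: "dist_to onorm (T j) (op_multiples scaleY (S j)) = onorm (T0 j)" for j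
  proof -
    have T0j: "T0 j = T j - (\<lambda>x. scaleY (z0 $ j) (S j x))"
      unfolding assms(8) by (rule comp)
    show ?thesis
      unfolding T0j using min[of j]
      by (intro dist_to_eqI) (auto simp: op_multiples_def T0j)
  qed
  then show ?thesis
    by (simp add: assms(9) eq)
qed

end
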